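(* Let $f:\mathbb{R}^n\to\mathbb{R}$ be continuously differentiable and bounded below by a constant $f_{\mathrm{low}}$, and consider a run of the trust-region algorithm described in the context. Assume there is $L\ge 1$ with $|f(x_k+s_k)-m_k(s_k)|\le \tfrac12(L+\|B_k\|)\|s_k\|^2$ for all $k\in\mathbb{N}$, and that there exist $\mu>0$ and $0<p\le 1$ such that $\max_{j=0,\ldots,k}\|B_j\|\le \mu(1+k^p)$ for all $k\in\mathbb{N}$. Assume that the algorithm generates infinitely many successful iterations. Let $\tau$ be a positive integer such that $\gamma_4\gamma_2^{\tau-1}<1$, let $\xi:=\sum_{k\in\mathbb{N}}(\gamma_4\gamma_2^{\tau-1})^{k/\tau}<\infty$, and let $$\kappa_1:=\frac{(f(x_0)-f_{\mathrm{low}})\,\psi_\beta(2\mu)}{\eta_1\kappa_{\mathrm{mdc}}a_{\min}}\ge 0.$$ Let $\epsilon>0$ and let $k_\epsilon$ be the first iteration such that $\|\nabla f(x_{k_\epsilon})\|\le\epsilon$. Define $$\kappa_3:=\psi_\beta(2\mu)\,\xi>0\qquad\text{and}\qquad \kappa_4:=\log_{\gamma_2}\left(\frac{a_{\min}}{\Delta_0}\right)+1>0.$$ If $0<p<1$, then $$k_\epsilon\le\left[(1-p)\left(\tau\kappa_1\epsilon^{-2}+\kappa_3\right)+\left((1-\alpha)\log_{\gamma_2}(\epsilon)+\kappa_4\right)^{1-p}\right]^{1/(1-p)}=O\left([(1-p)\epsilon^{-2}]^{1/(1-p)}\right).$$ If $p=1$, then $$k_\epsilon\le\left((1-\alpha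)\log_{\gamma_2}(\epsilon)+\kappa_4\right)\exp\left(\tau\kappa_1\epsilon^{-2}+\kappa_3\right).$$
   Context: $\|\cdot\|$ is the Euclidean norm for vectors and the induced norm for matrices; $\mathbb{N}=\{0,1,2,\ldots\}$; by convention $0^0=1$. Trust-region algorithm. Fix constants $0<\eta_1\le\eta_2<1$, $0<\gamma_1\le\gamma_2<1\le\gamma_3\le\gamma_4$, $0<\kappa_{\mathrm{mdc}}\le\frac12$, $-1\le\alpha\le1$, $0\le\beta\le1$, $x_0\in\mathbb{R}^n$, $\Delta_0>0$. For $k=0,1,\ldots$: choose a symmetric $B_k\in\mathbb{R}^{n\times n}$ and set $m_k(s):=f(x_k)+\nabla f(x_k)^Ts+\frac12 s^TB_ks$ and $r_k:=\frac{\|\nabla f(x_k)\|^\alpha}{(1+\|B_k\|)^\beta}\Delta_k$. Let $s_{k,\mathrm{cp}}:=-t_k\nabla f(x_k)$, where $t_k$ minimizes $m_k(-t\nabla f(x_k))$ over $t\ge0$ with $\|t\nabla f(x_k)\|\le r_k$. Compute any $s_k$ with $\|s_k\|\le r_k$ and $m_k(0)-m_k(s_k)\ge2\kappa_{\mathrm{mdc}}(m_k(0)-m_k(s_{k,\mathrm{cp}}))$. Let $\rho_k:=\frac{f(x_k)-f(x_k+s_k)}{m_k(0)-m_k(s_k)}$. If $\rho_k\ge\eta_1$, set $x_{k+1}:=x_k+s_k$; otherwise $x_{k+1}:=x_k$. Choose $\Delta_{k+1}\in[\gamma_3\Delta_k,\gamma_4\Delta_k]$ if $\rho_k\ge\eta_2$;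 $\Delta_{k+1}\in[\gamma_2\Delta_k,\Delta_k]$ if $\eta_1\le\rho_k<\eta_2$; $\Delta_{k+1}\in[\gamma_1\Delta_k,\gamma_2\Delta_k]$ if $\rho_k<\eta_1$. Iteration $k$ is successful if $\rho_k\ge\eta_1$. $a_{\min}:=2\gamma_1\kappa_{\mathrm{mdc}}(1-\eta_2)\min\left\{1,\frac{\Delta_0}{\|\nabla f(x_0)\|^{1-\alpha}}\right\}$. For $x\ge0$, $\psi_\beta(x):=L+x$ if $\beta\in[0,1/L]$ and $\psi_\beta(x):=L(1+x)$ if $\beta\in(1/L,1]$. $\log_{\gamma_2}$ is the logarithm in base $\gamma_2$. The $O(\cdot)$ notation refers to $\epsilon\to0$.
   Formalization: The claim κ_4>0, false in general, is replaced by (1-α)log_{γ_2}(ε)+κ_4>0 for 0<ε<‖∇f(x_0)‖; the p=1 bound is stated only when ε<‖∇f(x_0)‖ or that factor is ≥0, since otherwise k_ε=0 exceeds a negative right-hand side. *)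

theory Defs
  imports "HOL-Analysis.Analysis" "HOL-Library.Landau_Symbols"
begin

text \<open>
  Real power of a nonnegative base with the convention \<open>0\<^sup>0 = 1\<close>; the library's \<open>powr\<close>
  has \<open>0 powr 0 = 0\<close>.
\<close>
definition rpow :: "real \<Rightarrow> real \<Rightarrow> real" where
  "rpow x a = (if a = 0 then 1 else x powr a)"

text \<open>
  The matrix norm induced by the Euclidean norm. The type-class \<open>norm\<close> on \<open>real^'n^'m\<close> is the
  Frobenius norm instead.
\<close>
definition opnorm :: "real^'n^'m \<Rightarrow> real" where
  "opnorm A = onorm (\<lambda>v. A *v v)"

text \<open>Throughout, \<open>g\<close> stands for the gradient of \<open>f\<close>.\<close>

definition tr_model ::
  "(real^'n \<Rightarrow> real) \<Rightarrow> (real^'n \<Rightarrow> real^'n) \<Rightarrow> real^'n \<Rightarrow> real^'n^'n \<Rightarrow> real^'n \<Rightarrow> real" where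
  "tr_model f g x B s = f x + g x \<bullet> s + 1/2 * (s \<bullet> (B *v s))"

definition tr_radius ::
  "real \<Rightarrow> real \<Rightarrow> (real^'n \<Rightarrow> real^'n) \<Rightarrow> real^'n \<Rightarrow> real^'n^'n \<Rightarrow> real \<Rightarrow> real" where
  "tr_radius \<alpha> \<beta> g x B \<Delta> = rpow (norm (g x)) \<alpha> / rpow (1 + opnorm B) \<beta> * \<Delta>"

definition tr_ratio ::
  "(real^'n \<Rightarrow> real) \<Rightarrow> (real^'n \<Rightarrow> real^'n) \<Rightarrow> real^'n \<Rightarrow> real^'n^'n \<Rightarrow> real^'n \<Rightarrow> real" where
  "tr_ratio f g x B s = (f x - f (x + s)) / (tr_model f g x B 0 - tr_model f g x B s)"

definition tr_cauchy ::
  "real \<Rightarrow> real \<Rightarrow> (real^'n \<Rightarrow> real) \<Rightarrow> (real^'n \<Rightarrow> real^'n) \<Rightarrow> real^'n \<Rightarrow> real^'n^'n \<Rightarrow> real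
    \<Rightarrow> real^'n \<Rightarrow> bool" where
  "tr_cauchy \<alpha> \<beta> f g x B \<Delta> c \<longleftrightarrow>
    (\<exists>t. is_arg_min (\<lambda>t. tr_model f g x B (- t *\<^sub>R g x))
           (\<lambda>t. 0 \<le> t \<and> norm (t *\<^sub>R g x) \<le> tr_radius \<alpha> \<beta> g x B \<Delta>) t
         \<and> c = - t *\<^sub>R g x)"

text \<open>
  The sequences \<open>x\<close>, \<open>\<Delta>\<close>, \<open>B\<close>, \<open>s\<close> (iterates, radii, model Hessians, steps) form a run of the
  algorithm. The starting point and the initial radius are \<open>x 0\<close> and \<open>\<Delta> 0\<close>.
\<close>
definition tr_run ::
  "real \<Rightarrow> real \<Rightarrow> real \<Rightarrow> real \<Rightarrow> real \<Rightarrow> real \<Rightarrow> real \<Rightarrow> real \<Rightarrow> real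
    \<Rightarrow> (real^'n \<Rightarrow> real) \<Rightarrow> (real^'n \<Rightarrow> real^'n)
    \<Rightarrow> (nat \<Rightarrow> real^'n) \<Rightarrow> (nat \<Rightarrow> real) \<Rightarrow> (nat \<Rightarrow> real^'n^'n) \<Rightarrow> (nat \<Rightarrow> real^'n) \<Rightarrow> bool" where
  "tr_run \<eta>1 \<eta>2 \<gamma>1 \<gamma>2 \<gamma>3 \<gamma>4 \<kappa>mdc \<alpha> \<beta> f g x \<Delta> B s \<longleftrightarrow>
    0 < \<Delta> 0 \<and>
    (\<forall>k. transpose (B k) = B k \<and>
      norm (s k) \<le> tr_radius \<alpha> \<beta> g (x k) (B k) (\<Delta> k) \<and>
      (\<exists>c. tr_cauchy \<alpha> \<beta> f g (x k) (B k) (\<Delta> k) c \<and>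
        tr_model f g (x k) (B k) 0 - tr_model f g (x k) (B k) (s k)
          \<ge> 2 * \<kappa>mdc * (tr_model f g (x k) (B k) 0 - tr_model f g (x k) (B k) c)) \<and>
      (let \<rho> = tr_ratio f g (x k) (B k) (s k) in
        x (Suc k) = (if \<rho> \<ge> \<eta>1 then x k + s k else x k) \<and>
        (\<rho> \<ge> \<eta>2 \<longrightarrow> \<Delta> (Suc k) \<in> {\<gamma>3 * \<Delta> k .. \<gamma>4 * \<Delta> k}) \<and>
        (\<eta>1 \<le> \<rho> \<and> \<rho> < \<eta>2 \<longrightarrow> \<Delta> (Suc k) \<in> {\<gamma>2 * \<Delta> k .. \<Delta> k}) \<and>
        (\<rho> < \<eta>1 \<longrightarrow> \<Delta> (Suc k) \<in> {\<gamma>1 * \<Delta> k .. \<gamma>2 * \<Delta> k})))"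

text \<open>
  In \<open>min {1, \<Delta>\<^sub>0 / \<parallel>g\<^sub>0\<parallel>\<^bsup>1-\<alpha>\<^esup>}\<close> a vanishing denominator makes the quotient \<open>+\<infinity>\<close>, so the minimum
  is \<open>1\<close> (in HOL the quotient would be \<open>0\<close>). Here \<open>G0\<close> is the norm of the initial gradient.
\<close>
definition a_min :: "real \<Rightarrow> real \<Rightarrow> real \<Rightarrow> real \<Rightarrow> real \<Rightarrow> real \<Rightarrow> real" where
  "a_min \<gamma>1 \<kappa>mdc \<eta>2 \<alpha> \<Delta>0 G0 =
    2 * \<gamma>1 * \<kappa>mdc * (1 - \<eta>2) *
      (if rpow G0 (1 - \<alpha>) = 0 then 1 else min 1 (\<Delta>0 / rpow G0 (1 - \<alpha>)))"

definition \<psi> :: "real \<Rightarrow> real \<Rightarrow> real \<Rightarrow> real" where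
  "\<psi> L \<beta> x = (if \<beta> \<le> 1 / L then L + x else L * (1 + x))"

end

theory Submission
  imports Defs "HOL-Real_Asymp.Real_Asymp"
begin

text \<open>
  The proof is a worst-case count against a slowly growing model curvature. Write
  \<open>G\<^sub>k = \<parallel>\<nabla>f(x\<^sub>k)\<parallel>\<close> and \<open>H\<^sub>k = max\<^bsub>j\<le>k\<^esub> \<parallel>B\<^sub>j\<parallel>\<close>, and suppose that \<open>G\<^sub>i > \<epsilon>\<close> for all \<open>i < k\<close>.

  \<^bold>\<open>Radii do not collapse.\<close> Once the step bound \<open>r\<^sub>k\<close> is at most a fixed fraction of
  \<open>G\<^sub>k / (L + \<parallel>B\<^sub>k\<parallel>)\<close>, the model error is dominated by the Cauchy decrease, the ratio is at least
  \<open>\<eta>\<^sub>2\<close>, and the radius stops shrinking (\<open>very_successful_if_small_radius\<close>). Hence, for \<open>j < k\<close>,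
  \<open>\<Delta>\<^sub>j \<ge> a \<epsilon>\<^bsup>1-\<alpha>\<^esup> (1 + H\<^sub>j)\<^sup>\<beta> / \<psi>\<^sub>\<beta>(H\<^sub>j)\<close> (\<open>radius_ge\<close>). The right-hand side has to be nonincreasing in
  the curvature for this to propagate, and the two branches of \<open>\<psi>\<^sub>\<beta>\<close> are made for that
  (\<open>powr_over_\<psi>_antimono\<close>).

  \<^bold>\<open>Successes are paid by the objective.\<close> With such a radius, a success at \<open>j\<close> lowers \<open>f\<close> by at least
  \<open>\<eta>\<^sub>1 \<kappa>\<^sub>m\<^sub>d\<^sub>c a \<epsilon>\<^sup>2 / \<psi>\<^sub>\<beta>(H\<^sub>j)\<close>, and \<open>f\<close> can drop by at most \<open>f(x\<^sub>0) - f\<^sub>l\<^sub>o\<^sub>w\<close>. So the weights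
  \<open>w\<^sub>j = 1 / \<psi>\<^sub>\<beta>(H\<^sub>j)\<close> have a sum of order \<open>\<epsilon>\<^sup>-\<^sup>2\<close> over the successes (\<open>sum_successes_le\<close>).

  \<^bold>\<open>All other iterations.\<close> Fix a starting index \<open>m\<close>. An index \<open>j \<ge> m\<close> whose distance to \<open>m\<close> is less
  than \<open>\<tau>\<close> times the number of earlier successes is charged to one of these; each success receives
  at most \<open>\<tau>\<close> charges, and weights decrease, so these indices cost at most \<open>\<tau>\<close> times the
  sum over the successes (\<open>sum_charged_le\<close>). At any other \<open>j \<ge> m\<close>, successes have been so rare that
  \<open>\<Delta>\<^sub>j \<le> \<Delta>\<^sub>0 \<gamma>\<^sub>2\<^sup>m \<theta>\<^bsup>j-m\<^esup>\<close> with \<open>\<theta> = (\<gamma>\<^sub>4 \<gamma>\<^sub>2\<^bsup>\<tau>-1\<^esup>)\<^bsup>1/\<tau>\<^esup> < 1\<close>. Against the lower bound on the radii this forces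
  \<open>w\<^sub>j \<le> \<theta>\<^bsup>j-m\<^esup>\<close> as soon as \<open>\<Delta>\<^sub>0 \<gamma>\<^sub>2\<^sup>m \<le> a \<epsilon>\<^bsup>1-\<alpha>\<^esup>\<close>, so their total is at most \<open>\<xi>\<close> (\<open>sum_uncharged_le\<close>). The
  smallest such \<open>m\<close> is at most \<open>(1-\<alpha>) log\<^bsub>\<gamma>2\<^esub> \<epsilon> + \<kappa>\<^sub>4\<close> (\<open>start_index\<close>); this is where the logarithmic term
  of the bound comes from.

  \<^bold>\<open>Conclusion.\<close> The growth hypothesis gives \<open>j\<^bsup>-p\<^esup> \<le> \<psi>\<^sub>\<beta>(2\<mu>) w\<^sub>j\<close>, so \<open>\<Sum> j\<^bsup>-p\<^esup>\<close> over \<open>m \<le> j < k\<close> is at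
  most \<open>\<tau> \<kappa>\<^sub>1 \<epsilon>\<^sup>-\<^sup>2 + \<kappa>\<^sub>3\<close> (\<open>sum_power_le\<close>). Comparing this sum with \<open>\<integral> t\<^bsup>-p\<^esup> dt\<close> bounds \<open>k\<close>. As
  \<open>\<Sum> j\<^bsup>-p\<^esup>\<close> diverges for \<open>p \<le> 1\<close>, the same inequality shows that the tolerance is reached at all.
\<close>
section \<open>Real powers and the curvature function\<close>

lemma rpow_pos_base: "0 < x \<Longrightarrow> rpow x r = x powr r"
  by (simp add: rpow_def)

text \<open>
  Both places where real powers have to be compared with linear functions, the monotonicity of
  \<open>(1 + u)\<^sup>\<beta> / \<psi>\<^sub>\<beta>(u)\<close> and the comparison of a power sum with its integral, reduce to this inequality.
  It is convexity of \<open>exp\<close> between \<open>0\<close> and \<open>ln (1 + t)\<close>.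
\<close>
lemma powr_Bernoulli:
  fixes t r :: real
  assumes "0 \<le> t" "0 \<le> r" "r \<le> 1"
  shows "(1 + t) powr r \<le> 1 + r * t"
proof -
  have "exp ((1 - r) *\<^sub>R 0 + r *\<^sub>R ln (1 + t)) \<le> (1 - r) * exp 0 + r * exp (ln (1 + t))"
    by (rule convex_onD[OF exp_convex]) (use assms in auto)
  with assms show ?thesis
    by (simp add: powr_def algebra_simps)
qed

lemma \<psi>_ge: "\<lbrakk>1 \<le> L; 0 \<le> u\<rbrakk> \<Longrightarrow> L + u \<le> \<psi> L \<beta> u"
  using mult_right_mono[of 1 L u] by (simp add: \<psi>_def algebra_simps)

lemma \<psi>_pos: "\<lbrakk>1 \<le> L; 0 \<le> u\<rbrakk> \<Longrightarrow> 0 < \<psi> L \<beta> u"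
  using \<psi>_ge[of L u \<beta>] by linarith

lemma \<psi>_mono: "\<lbrakk>1 \<le> L; u \<le> v\<rbrakk> \<Longrightarrow> \<psi> L \<beta> u \<le> \<psi> L \<beta> v"
  by (simp add: \<psi>_def)

lemma \<psi>_scale_le: "\<lbrakk>1 \<le> L; 1 \<le> t\<rbrakk> \<Longrightarrow> \<psi> L \<beta> (c * t) \<le> \<psi> L \<beta> c * t"
  using mult_left_mono[of 1 t L] by (auto simp: \<psi>_def algebra_simps)

text \<open>
  This explains the case distinction in \<open>\<psi>\<^sub>\<beta>\<close>. The logarithmic derivative of \<open>(1 + u)\<^sup>\<beta> / (L + u)\<close> is
  \<open>\<beta> / (1 + u) - 1 / (L + u)\<close>, which is nonpositive for all \<open>u \<ge> 0\<close> exactly when it is so at \<open>u = 0\<close>, that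
  is, when \<open>\<beta> \<le> 1 / L\<close>. For larger \<open>\<beta>\<close> the denominator \<open>L + u\<close> is coarsened to \<open>L (1 + u)\<close>, which
  leaves the nonincreasing function \<open>(1 + u)\<^bsup>\<beta>-1\<^esup> / L\<close>.
\<close>
lemma powr_over_\<psi>_antimono:
  assumes "1 \<le> L" "0 \<le> \<beta>" "\<beta> \<le> 1" "0 \<le> u" "u \<le> v"
  shows "(1 + v) powr \<beta> / \<psi> L \<beta> v \<le> (1 + u) powr \<beta> / \<psi> L \<beta> u"
proof -
  define t where "t = (v - u) / (1 + u)"
  have t: "0 \<le> t" and v_eq: "1 + v = (1 + u) * (1 + t)"
    using assms by (auto simp: t_def field_simps)
  have "(1 + v) powr \<beta> = (1 + u) powr \<beta> * (1 + t) powr \<beta>"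
    using assms t by (simp add: v_eq powr_mult)
  also have "\<dots> \<le> (1 + u) powr \<beta> * (1 + \<beta> * t)"
    by (intro mult_left_mono powr_Bernoulli) (use assms t in auto)
  finally have powr_le: "(1 + v) powr \<beta> \<le> (1 + u) powr \<beta> * (1 + \<beta> * t)" .
  have "1 + \<beta> * t \<le> \<psi> L \<beta> v / \<psi> L \<beta> u"
  proof (cases "\<beta> \<le> 1 / L")
    case True
    have "\<beta> * L \<le> 1"
      using True assms by (simp add: field_simps)
    moreover have "\<beta> * u \<le> u"
      using assms mult_right_mono[of \<beta> 1 u] by simp
    ultimately have "\<beta> * (L + u) \<le> 1 + u"
      by (simp add: algebra_simps)
    then have "\<beta> * (L + u) * (v - u) \<le> (1 + u) * (v - u)"
      using assms by (intro mult_right_mono) auto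
    then have "\<beta> * t \<le> (v - u) / (L + u)"
      using assms by (simp add: t_def field_simps)
    moreover have "1 + (v - u) / (L + u) = (L + v) / (L + u)"
      using assms by (simp add: field_simps)
    ultimately show ?thesis
      using True by (simp add: \<psi>_def)
  next
    case False
    have "1 + \<beta> * t \<le> 1 + t"
      using assms t mult_right_mono[of \<beta> 1 t] by simp
    also have "\<dots> = \<psi> L \<beta> v / \<psi> L \<beta> u"
      using False assms by (simp add: \<psi>_def v_eq)
    finally show ?thesis .
  qed
  with powr_le have "(1 + v) powr \<beta> \<le> (1 + u) powr \<beta> * (\<psi> L \<beta> v / \<psi> L \<beta> u)"
    by (meson mult_left_mono order_trans powr_ge_zero)
  then show ?thesis
    using assms \<psi>_pos[of L u \<beta>] \<psi>_pos[of L v \<beta>] by (simp add: field_simps)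
qed

section \<open>Power sums and iteration counts\<close>

text \<open>
  The left-hand side is \<open>(1 - p)\<close> times the integral of \<open>t\<^bsup>-p\<^esup>\<close> over \<open>[m, k]\<close>, so this is the integral
  test for a nonincreasing integrand. Each single step is the Bernoulli inequality for
  \<open>(1 + 1/j)\<^bsup>1-p\<^esup>\<close>.
\<close>
lemma powr_diff_le_sum:
  fixes p :: real
  assumes "0 \<le> p" "p \<le> 1" "0 < m" "m \<le> k"
  shows "real k powr (1 - p) - real m powr (1 - p) \<le> (1 - p) * (\<Sum>j\<in>{m..<k}. real j powr (-p))"
  using assms(4)
proof (induction rule: dec_induct)
  case base
  then show ?case by simp
next
  case (step j)
  have j: "0 < real j"
    using step assms by simp
  have "real (Suc j) = real j * (1 + 1 / real j)"
    using j by (simp add: field_simps)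
  then have "real (Suc j) powr (1 - p) = real j powr (1 - p) * (1 + 1 / real j) powr (1 - p)"
    using j by (simp add: powr_mult)
  also have "\<dots> \<le> real j powr (1 - p) * (1 + (1 - p) * (1 / real j))"
    by (intro mult_left_mono powr_Bernoulli) (use assms in auto)
  also have "\<dots> = real j powr (1 - p) + (1 - p) * real j powr (-p)"
    using j by (simp add: powr_diff powr_minus field_simps)
  finally show ?case
    using step by (simp add: algebra_simps)
qed

lemma ln_diff_le_sum:
  assumes "0 < m" "m \<le> k"
  shows "ln (real k) - ln (real m) \<le> (\<Sum>j\<in>{m..<k}. 1 / real j)"
  using assms(2)
proof (induction rule: dec_induct)
  case base
  then show ?case by simp
next
  case (step j)
  have j: "0 < real j"
    using step assms by simp
  have "real (Suc j) = real j * (1 + 1 / real j)"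
    using j by (simp add: field_simps)
  then have "ln (real (Suc j)) = ln (real j) + ln (1 + 1 / real j)"
    using j by (simp add: ln_mult_pos add_pos_pos)
  also have "\<dots> \<le> ln (real j) + 1 / real j"
    using j by (intro add_left_mono ln_add_one_self_le_self) auto
  finally show ?case
    using step by simp
qed

text \<open>
  Here \<open>Z\<close> stands for the real number that the integer \<open>m\<close> approximates from below. An index \<open>k < m\<close>,
  for which the sum is empty, satisfies the bound because already \<open>k \<le> Z\<close>.
\<close>
lemma count_le_of_power_sum:
  fixes A Z p :: real
  assumes "0 \<le> p" "p < 1" "0 \<le> A" "0 < m" "real m \<le> Z"
    and sum_le: "(\<Sum>j\<in>{m..<k}. real j powr (-p)) \<le> A"
  shows "real k \<le> ((1 - p) * A + Z powr (1 - p)) powr (1 / (1 - p))"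
proof -
  have Z: "real m powr (1 - p) \<le> Z powr (1 - p)"
    using assms by (intro powr_mono2) auto
  have "real k powr (1 - p) \<le> (1 - p) * A + Z powr (1 - p)"
  proof (cases "m \<le> k")
    case True
    have "real k powr (1 - p) - real m powr (1 - p) \<le> (1 - p) * (\<Sum>j\<in>{m..<k}. real j powr (-p))"
      using assms True by (intro powr_diff_le_sum) auto
    also have "\<dots> \<le> (1 - p) * A"
      using assms by (intro mult_left_mono) auto
    finally show ?thesis
      using Z by linarith
  next
    case False
    then have "real k powr (1 - p) \<le> real m powr (1 - p)"
      using assms by (intro powr_mono2) auto
    moreover have "0 \<le> (1 - p) * A"
      using assms by simp
    ultimately show ?thesis
      using Z by linarith
  qed
  then have "(real k powr (1 - p)) powr (1 / (1 - p))
      \<le> ((1 - p) * A + Z powr (1 - p)) powr (1 / (1 - p))"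
    using assms by (intro powr_mono2) auto
  then show ?thesis
    using assms by (simp add: powr_powr)
qed

lemma count_le_of_harmonic_sum:
  fixes A Z :: real
  assumes "0 \<le> A" "0 < m" "real m \<le> Z"
    and sum_le: "(\<Sum>j\<in>{m..<k}. 1 / real j) \<le> A"
  shows "real k \<le> Z * exp A"
proof (cases "m \<le> k")
  case True
  have "ln (real k) \<le> ln (real m) + A"
    using ln_diff_le_sum[OF assms(2) True] sum_le by linarith
  then have "exp (ln (real k)) \<le> exp (ln (real m) + A)"
    by (rule exp_le_cancel_iff[THEN iffD2])
  then have "real k \<le> real m * exp A"
    using True assms by (simp add: exp_add)
  also have "\<dots> \<le> Z * exp A"
    using assms by (intro mult_right_mono) auto
  finally show ?thesis .
next
  case False
  then have "real k * 1 \<le> Z * exp A"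
    using assms by (intro mult_mono) auto
  then show ?thesis by simp
qed

text \<open>
  The logarithmic term does not disturb the order: \<open>log \<epsilon>\<close> grows slower than any negative power
  of \<open>\<epsilon>\<close>. For \<open>d = 0\<close> the argument
  \<open>z\<close> may be negative, but then the power is a constant.
\<close>
lemma iteration_bound_bigo:
  fixes p c d e z b :: real
  assumes "0 < p" "p < 1" "0 \<le> c" "0 \<le> e" "0 < b" "b < 1" "0 \<le> d"
  shows "(\<lambda>\<epsilon>. ((1 - p) * (c * \<epsilon> powr (-2) + e) + (d * log b \<epsilon> + z) powr (1 - p)) powr (1 / (1 - p)))
    \<in> O[at_right 0](\<lambda>\<epsilon>. ((1 - p) * \<epsilon> powr (-2)) powr (1 / (1 - p)))"
proof (rule bigo_powr_nonneg)
  have "(\<lambda>\<epsilon>. (d * log b \<epsilon> + z) powr (1 - p)) \<in> O[at_right 0](\<lambda>\<epsilon>. \<epsilon> powr (-2))"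
  proof (cases "d = 0")
    case True
    then show ?thesis
      by simp real_asymp
  next
    case False
    define l where "l = - d / ln b"
    have "0 < l"
      using False assms by (simp add: l_def divide_neg_neg divide_pos_neg)
    then have "(\<lambda>\<epsilon>. (- l * ln \<epsilon> + z) powr (1 - p)) \<in> O[at_right 0](\<lambda>\<epsilon>. \<epsilon> powr (-2))"
      using assms by real_asymp
    then show ?thesis
      by (simp add: l_def log_def)
  qed
  moreover have "(\<lambda>\<epsilon>. (1 - p) * (c * \<epsilon> powr (-2) + e)) \<in> O[at_right 0](\<lambda>\<epsilon>. \<epsilon> powr (-2))"
  proof -
    have "(\<lambda>\<epsilon>. e) \<in> O[at_right 0](\<lambda>\<epsilon>::real. \<epsilon> powr (-2))"
      by real_asymp
    then have "(\<lambda>\<epsilon>. c * \<epsilon> powr (-2) + e) \<in> O[at_right 0](\<lambda>\<epsilon>. \<epsilon> powr (-2))"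
      by (intro sum_in_bigo) auto
    then show ?thesis
      by simp
  qed
  ultimately show "(\<lambda>\<epsilon>. (1 - p) * (c * \<epsilon> powr (-2) + e) + (d * log b \<epsilon> + z) powr (1 - p))
      \<in> O[at_right 0](\<lambda>\<epsilon>. (1 - p) * \<epsilon> powr (-2))"
    using assms by (simp add: sum_in_bigo)
qed (use assms in auto)

section \<open>Charging iterations to successes\<close>

text \<open>
  Each success has \<open>\<tau>\<close> places for later indices, and an index \<open>j \<ge> m\<close> satisfying the condition finds
  a free place: at most \<open>j - m\<close> indices are charged before it, fewer than the available
  \<open>\<tau> * card (S \<inter> {..<j})\<close> places. As \<open>w\<close> is nonincreasing, each index costs at most what its
  success pays. Induction on \<open>k\<close> avoids constructing the assignment explicitly.
\<close>
lemma sum_charged_le: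
  fixes w :: "nat \<Rightarrow> real" and S :: "nat set" and \<tau> m k :: nat
  assumes antimono: "antimono w" and nonneg: "\<And>j. 0 \<le> w j"
  shows "(\<Sum>j | m \<le> j \<and> j < k \<and> j - m < \<tau> * card (S \<inter> {..<j}). w j)
    \<le> real \<tau> * (\<Sum>j\<in>S \<inter> {..<k}. w j)"
proof -
  define C where "C k = {j. m \<le> j \<and> j < k \<and> j - m < \<tau> * card (S \<inter> {..<j})}" for k
  define N where "N k = card (S \<inter> {..<k})" for k
  have fin: "finite (C k)" for k
    unfolding C_def by simp
  \<comment> \<open>A success at \<open>j\<close> buys \<open>\<tau>\<close> credits of value \<open>w j\<close>, a charged index spends one; unspent
    credits are kept at the current, smaller price.\<close>
  have "card (C k) \<le> \<tau> * N k \<and>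
    sum w (C k) + (real (\<tau> * N k) - real (card (C k))) * w k \<le> real \<tau> * sum w (S \<inter> {..<k})"
  proof (induction k)
    case 0
    show ?case
      by (simp add: C_def N_def)
  next
    case (Suc k)
    define A where "A = sum w (C k) + (real (\<tau> * N k) - real (card (C k))) * w k"
    have C_Suc: "C (Suc k) = (if m \<le> k \<and> k - m < \<tau> * N k then insert k (C k) else C k)"
      by (auto simp: C_def N_def less_Suc_eq)
    have k_notin: "k \<notin> C k"
      by (simp add: C_def)
    have spend: "card (C (Suc k)) \<le> \<tau> * N k \<and>
      sum w (C (Suc k)) + (real (\<tau> * N k) - real (card (C (Suc k)))) * w k = A"
    proof (cases "m \<le> k \<and> k - m < \<tau> * N k")
      case True
      have "C k \<subseteq> {m..<k}"
        by (auto simp: C_def)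
      then have "card (C k) \<le> k - m"
        using card_mono[of "{m..<k}"] by simp
      then show ?thesis
        using True fin k_notin by (simp add: C_Suc A_def algebra_simps)
    next
      case False
      then show ?thesis
        using Suc by (simp add: C_Suc A_def if_not_P[OF False])
    qed
    have S_Suc: "S \<inter> {..<Suc k} = (if k \<in> S then insert k (S \<inter> {..<k}) else S \<inter> {..<k})"
      by (auto simp: less_Suc_eq)
    have earn: "N k \<le> N (Suc k)" "real \<tau> * sum w (S \<inter> {..<Suc k}) =
        real \<tau> * sum w (S \<inter> {..<k}) + (real (\<tau> * N (Suc k)) - real (\<tau> * N k)) * w k"
      by (auto simp: N_def S_Suc algebra_simps)
    have card_le: "card (C (Suc k)) \<le> \<tau> * N (Suc k)"
      using spend earn(1) by (meson mult_le_mono2 order_trans)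
    have "(real (\<tau> * N (Suc k)) - real (card (C (Suc k)))) * w (Suc k)
        \<le> (real (\<tau> * N (Suc k)) - real (card (C (Suc k)))) * w k"
      using card_le antimonoD[OF antimono, of k "Suc k"] of_nat_mono[OF card_le, where 'a = real]
      by (intro mult_left_mono) auto
    then have "sum w (C (Suc k)) + (real (\<tau> * N (Suc k)) - real (card (C (Suc k)))) * w (Suc k)
        \<le> A + (real (\<tau> * N (Suc k)) - real (\<tau> * N k)) * w k"
      using spend by (simp add: algebra_simps)
    also have "\<dots> \<le> real \<tau> * sum w (S \<inter> {..<Suc k})"
      using Suc by (simp add: A_def earn(2))
    finally show ?case
      using card_le by simp
  qed
  moreover have "0 \<le> (real (\<tau> * N k) - real (card (C k))) * w k"
    using calculation nonneg[of k] of_nat_mono[of "card (C k)" "\<tau> * N k", where 'a = real]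
    by (intro mult_nonneg_nonneg) auto
  ultimately show ?thesis
    unfolding C_def by linarith
qed

section \<open>Model curvature\<close>

lemma opnorm_nonneg: "0 \<le> opnorm A"
  for A :: "real^'n^'m"
  unfolding opnorm_def by (rule onorm_pos_le) simp

lemma quadratic_form_le_opnorm: "v \<bullet> (A *v v) \<le> opnorm A * (norm v)\<^sup>2"
  for A :: "real^'n^'n"
proof -
  have "v \<bullet> (A *v v) \<le> norm v * norm (A *v v)"
    by (rule norm_cauchy_schwarz)
  also have "\<dots> \<le> norm v * (opnorm A * norm v)"
    unfolding opnorm_def by (intro mult_left_mono onorm) auto
  finally show ?thesis
    by (simp add: power2_eq_square mult_ac)
qed

text \<open>
  Along \<open>- t \<nabla>f\<close> the model falls by \<open>t \<parallel>\<nabla>f\<parallel>\<^sup>2 - t\<^sup>2 (\<nabla>f \<bullet> A \<nabla>f) / 2\<close>. For \<open>t \<parallel>A\<parallel> \<le> 1\<close> the quadratic term eats at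
  most half of the linear one. The witness is the largest feasible \<open>t \<le> 1 / (1 + \<parallel>A\<parallel>)\<close>; the \<open>1\<close> in the
  denominator keeps it finite for \<open>A = 0\<close>.
\<close>
lemma cauchy_decrease:
  assumes cp: "tr_cauchy \<alpha> \<beta> f g y A \<delta> c"
    and r: "r = tr_radius \<alpha> \<beta> g y A \<delta>" "0 \<le> r" and G: "0 < norm (g y)"
  shows "1/2 * norm (g y) * min r (norm (g y) / (1 + opnorm A))
    \<le> tr_model f g y A 0 - tr_model f g y A c"
proof -
  let ?G = "norm (g y)" and ?b = "opnorm A"
  define t where "t = min (r / ?G) (1 / (1 + ?b))"
  have b: "0 \<le> ?b"
    by (rule opnorm_nonneg)
  have t0: "0 \<le> t"
    using r G b by (simp add: t_def)
  have feasible: "norm (t *\<^sub>R g y) \<le> tr_radius \<alpha> \<beta> g y A \<delta>"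
  proof -
    have "t * ?G \<le> r / ?G * ?G"
      using G by (intro mult_right_mono) (auto simp: t_def)
    then show ?thesis
      using G t0 r by simp
  qed
  have "t * ?b \<le> 1 / (1 + ?b) * (1 + ?b)"
    using b t0 by (intro mult_mono) (auto simp: t_def)
  then have tb: "t * ?b \<le> 1"
    using b by simp
  have "tr_model f g y A c \<le> tr_model f g y A (- t *\<^sub>R g y)"
    using cp t0 feasible by (force simp: tr_cauchy_def is_arg_min_linorder)
  moreover have "tr_model f g y A 0 - tr_model f g y A (- t *\<^sub>R g y)
      = t * ?G\<^sup>2 - 1/2 * t\<^sup>2 * (g y \<bullet> (A *v g y))"
    by (simp add: tr_model_def matrix_vector_mult_scaleR dot_square_norm power2_eq_square
        flip: scaleR_minus_left)
  moreover have "1/2 * t\<^sup>2 * (g y \<bullet> (A *v g y)) \<le> 1/2 * t * ?G\<^sup>2"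
  proof -
    have "t\<^sup>2 * (g y \<bullet> (A *v g y)) \<le> t\<^sup>2 * (?b * ?G\<^sup>2)"
      by (intro mult_left_mono quadratic_form_le_opnorm) auto
    also have "\<dots> = (t * ?b) * (t * ?G\<^sup>2)"
      by (simp add: power2_eq_square)
    also have "\<dots> \<le> 1 * (t * ?G\<^sup>2)"
      using tb t0 by (intro mult_right_mono) auto
    finally show ?thesis
      by simp
  qed
  moreover have "t * ?G\<^sup>2 = ?G * min r (?G / (1 + ?b))"
  proof -
    have "t * ?G = min (r / ?G * ?G) (1 / (1 + ?b) * ?G)"
      using G unfolding t_def by (subst min_mult_distrib_right) simp
    then show ?thesis
      using G by (simp add: power2_eq_square mult_ac)
  qed
  ultimately show ?thesis
    by linarith
qed

section \<open>Runs of the algorithm\<close>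

locale trust_region_run =
  fixes f :: "real^'n \<Rightarrow> real" and g :: "real^'n \<Rightarrow> real^'n"
    and x s :: "nat \<Rightarrow> real^'n" and B :: "nat \<Rightarrow> real^'n^'n" and \<Delta> :: "nat \<Rightarrow> real"
    and \<eta>1 \<eta>2 \<gamma>1 \<gamma>2 \<gamma>3 \<gamma>4 \<kappa>mdc \<alpha> \<beta> L flow :: real
  assumes \<eta>1: "0 < \<eta>1" and \<eta>2: "\<eta>1 \<le> \<eta>2" "\<eta>2 < 1"
    and \<gamma>: "0 < \<gamma>1" "\<gamma>1 \<le> \<gamma>2" "\<gamma>2 < 1" "1 \<le> \<gamma>3" "\<gamma>3 \<le> \<gamma>4"
    and \<kappa>: "0 < \<kappa>mdc" "\<kappa>mdc \<le> 1/2"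
    and \<alpha>: "-1 \<le> \<alpha>" "\<alpha> \<le> 1" and \<beta>: "0 \<le> \<beta>" "\<beta> \<le> 1"
    and bounded_below: "\<And>y. flow \<le> f y"
    and run: "tr_run \<eta>1 \<eta>2 \<gamma>1 \<gamma>2 \<gamma>3 \<gamma>4 \<kappa>mdc \<alpha> \<beta> f g x \<Delta> B s"
    and L: "1 \<le> L"
    and model_error: "\<And>k. \<bar>f (x k + s k) - tr_model f g (x k) (B k) (s k)\<bar>
                        \<le> 1/2 * (L + opnorm (B k)) * (norm (s k))\<^sup>2"
begin

abbreviation G :: "nat \<Rightarrow> real" where "G k \<equiv> norm (g (x k))"

abbreviation b :: "nat \<Rightarrow> real" where "b k \<equiv> opnorm (B k)"

definition H :: "nat \<Rightarrow> real" where "H k = (MAX j\<in>{0..k}. b j)"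

definition r :: "nat \<Rightarrow> real" where "r k = tr_radius \<alpha> \<beta> g (x k) (B k) (\<Delta> k)"

definition predicted :: "nat \<Rightarrow> real" where
  "predicted k = tr_model f g (x k) (B k) 0 - tr_model f g (x k) (B k) (s k)"

definition \<rho> :: "nat \<Rightarrow> real" where "\<rho> k = tr_ratio f g (x k) (B k) (s k)"

definition successes :: "nat set" where "successes = {k. \<eta>1 \<le> \<rho> k}"

definition a :: real where "a = a_min \<gamma>1 \<kappa>mdc \<eta>2 \<alpha> (\<Delta> 0) (G 0)"

text \<open>
  The curvature factor in the radius: for every \<open>c\<close>, \<open>\<Delta>\<^sub>k \<le> c G\<^sub>k\<^bsup>1-\<alpha>\<^esup> \<Phi>(\<parallel>B\<^sub>k\<parallel>)\<close> holds exactly when the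
  step bound satisfies \<open>r\<^sub>k \<le> c G\<^sub>k / \<psi>\<^sub>\<beta>(\<parallel>B\<^sub>k\<parallel>)\<close>. The powers of \<open>G\<^sub>k\<close> and \<open>1 + \<parallel>B\<^sub>k\<parallel>\<close> in the step bound cancel.
\<close>
definition \<Phi> :: "real \<Rightarrow> real" where "\<Phi> u = (1 + u) powr \<beta> / \<psi> L \<beta> u"

lemma \<rho>_eq: "\<rho> k = (f (x k) - f (x k + s k)) / predicted k"
  by (simp add: \<rho>_def predicted_def tr_ratio_def)

lemma \<Delta>0_pos: "0 < \<Delta> 0"
  using run by (simp add: tr_run_def)

lemma step_in_radius: "norm (s k) \<le> r k"
  using run by (simp add: tr_run_def r_def)

lemma iterate_update: "x (Suc k) = (if k \<in> successes then x k + s k else x k)"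
  using run by (simp add: tr_run_def Let_def successes_def \<rho>_def)

lemma radius_update:
  "\<eta>2 \<le> \<rho> k \<Longrightarrow> \<Delta> (Suc k) \<in> {\<gamma>3 * \<Delta> k .. \<gamma>4 * \<Delta> k}"
  "\<lbrakk>\<eta>1 \<le> \<rho> k; \<rho> k < \<eta>2\<rbrakk> \<Longrightarrow> \<Delta> (Suc k) \<in> {\<gamma>2 * \<Delta> k .. \<Delta> k}"
  "\<rho> k < \<eta>1 \<Longrightarrow> \<Delta> (Suc k) \<in> {\<gamma>1 * \<Delta> k .. \<gamma>2 * \<Delta> k}"
  using run by (simp_all add: tr_run_def Let_def \<rho>_def)

lemma radius_pos: "0 < \<Delta> k"
  and radius_shrink: "\<gamma>1 * \<Delta> k \<le> \<Delta> (Suc k)"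
proof -
  have shrink: "\<gamma>1 * \<Delta> k \<le> \<Delta> (Suc k)" if "0 < \<Delta> k" for k
  proof -
    have "\<gamma>1 * \<Delta> k \<le> \<gamma>2 * \<Delta> k" "\<gamma>2 * \<Delta> k \<le> 1 * \<Delta> k" "1 * \<Delta> k \<le> \<gamma>3 * \<Delta> k"
      using that \<gamma> by (intro mult_right_mono; simp)+
    then show ?thesis
      using radius_update[of k] by fastforce
  qed
  show pos: "0 < \<Delta> k" for k
  proof (induction k)
    case (Suc k)
    then show ?case
      using shrink[of k] \<gamma>(1) mult_pos_pos[of \<gamma>1 "\<Delta> k"] by linarith
  qed (rule \<Delta>0_pos)
  show "\<gamma>1 * \<Delta> k \<le> \<Delta> (Suc k)"
    by (rule shrink[OF pos])
qed

lemma b_nonneg: "0 \<le> b k"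
  by (rule opnorm_nonneg)

lemma b_le_H: "b k \<le> H k"
  unfolding H_def by (rule Max_ge) auto

lemma H_nonneg: "0 \<le> H k"
  using b_nonneg b_le_H order_trans by blast

lemma mono_H: "mono H"
  unfolding H_def by (intro monoI Max_mono) auto

lemma r_eq:
  assumes "0 < G k"
  shows "r k = G k powr \<alpha> * \<Delta> k / (1 + b k) powr \<beta>"
  using assms b_nonneg[of k] by (simp add: r_def tr_radius_def rpow_pos_base)

lemma r_pos: "0 < G k \<Longrightarrow> 0 < r k"
  using b_nonneg[of k] radius_pos[of k] by (auto simp: r_eq intro!: divide_pos_pos mult_pos_pos)

section \<open>Lower bound on the radii\<close>
lemma predicted_ge:
  assumes "0 < G k"
  shows "\<kappa>mdc * (G k * min (r k) (G k / (1 + b k))) \<le> predicted k"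
proof -
  obtain c where c: "tr_cauchy \<alpha> \<beta> f g (x k) (B k) (\<Delta> k) c"
    and "2 * \<kappa>mdc * (tr_model f g (x k) (B k) 0 - tr_model f g (x k) (B k) c) \<le> predicted k"
    using run unfolding tr_run_def predicted_def by blast
  moreover have "1/2 * G k * min (r k) (G k / (1 + b k))
      \<le> tr_model f g (x k) (B k) 0 - tr_model f g (x k) (B k) c"
    using assms r_pos[OF assms] by (intro cauchy_decrease[OF c]) (auto simp: r_def)
  then have "2 * \<kappa>mdc * (1/2 * G k * min (r k) (G k / (1 + b k)))
      \<le> 2 * \<kappa>mdc * (tr_model f g (x k) (B k) 0 - tr_model f g (x k) (B k) c)"
    using \<kappa> by (intro mult_left_mono) auto
  ultimately show ?thesis
    by simp
qed

lemma predicted_pos: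
  assumes "0 < G k"
  shows "0 < predicted k"
proof -
  have "0 < \<kappa>mdc * (G k * min (r k) (G k / (1 + b k)))"
    using assms \<kappa> r_pos[OF assms] b_nonneg[of k] by simp
  with predicted_ge[OF assms] show ?thesis
    by linarith
qed

text \<open>
  The model error is of order \<open>(L + \<parallel>B\<^sub>k\<parallel>) r\<^sub>k\<^sup>2\<close>, while the predicted decrease is of order \<open>G\<^sub>k r\<^sub>k\<close>. Their
  quotient is at most \<open>1 - \<eta>2\<close> under the hypothesis on \<open>r\<^sub>k\<close>.
\<close>
lemma very_successful_if_small_radius:
  assumes G: "0 < G k" and r_le: "r k \<le> 2 * \<kappa>mdc * (1 - \<eta>2) * (G k / (L + b k))"
  shows "\<eta>2 \<le> \<rho> k"
proof -
  have Lb: "0 < L + b k"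
    using L b_nonneg[of k] by linarith
  \<comment> \<open>The hypothesis also makes \<open>r k\<close> the smaller of the two terms in the Cauchy bound.\<close>
  have "2 * \<kappa>mdc * (1 - \<eta>2) \<le> 1 * 1"
    using \<kappa> \<eta>1 \<eta>2 by (intro mult_mono) auto
  then have "2 * \<kappa>mdc * (1 - \<eta>2) * (G k / (L + b k)) \<le> 1 * (G k / (L + b k))"
    using Lb by (intro mult_right_mono) auto
  also have "\<dots> \<le> G k / (1 + b k)"
    using L b_nonneg[of k] by (simp add: frac_le)
  finally have "\<kappa>mdc * (G k * r k) \<le> predicted k"
    using predicted_ge[OF G] r_le by simp
  then have pred: "(1 - \<eta>2) * (\<kappa>mdc * (G k * r k)) \<le> (1 - \<eta>2) * predicted k"
    using \<eta>2 by (intro mult_left_mono) auto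
  have "\<bar>f (x k + s k) - tr_model f g (x k) (B k) (s k)\<bar> \<le> 1/2 * (L + b k) * (norm (s k))\<^sup>2"
    by (rule model_error)
  also have "\<dots> \<le> 1/2 * (L + b k) * (r k)\<^sup>2"
    using step_in_radius Lb by (intro mult_left_mono power_mono) auto
  also have "\<dots> = 1/2 * (r k * (L + b k)) * r k"
    by (simp add: power2_eq_square)
  also have "\<dots> \<le> 1/2 * (2 * \<kappa>mdc * (1 - \<eta>2) * G k) * r k"
    using r_le Lb r_pos[OF G] by (intro mult_right_mono mult_left_mono) (auto simp: field_simps)
  also have "\<dots> = (1 - \<eta>2) * (\<kappa>mdc * (G k * r k))"
    by (simp add: algebra_simps)
  also note pred
  finally have "f (x k + s k) - tr_model f g (x k) (B k) (s k) \<le> (1 - \<eta>2) * predicted k"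
    by linarith
  moreover have "predicted k = f (x k) - tr_model f g (x k) (B k) (s k)"
    by (simp add: predicted_def tr_model_def)
  ultimately have "\<eta>2 * predicted k \<le> f (x k) - f (x k + s k)"
    unfolding left_diff_distrib mult_1_left by linarith
  then show ?thesis
    using predicted_pos[OF G] by (simp add: \<rho>_eq field_simps)
qed

lemma a_factor_lt: "2 * \<gamma>1 * \<kappa>mdc * (1 - \<eta>2) < \<gamma>1"
proof -
  have "2 * \<kappa>mdc * (1 - \<eta>2) \<le> 1 * (1 - \<eta>2)"
    using \<kappa> \<eta>2 by (intro mult_right_mono) auto
  also have "\<dots> < 1"
    using \<eta>1 \<eta>2 by simp
  finally have "\<gamma>1 * (2 * \<kappa>mdc * (1 - \<eta>2)) < \<gamma>1 * 1"
    using \<gamma> by (intro mult_strict_left_mono) auto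
  then show ?thesis
    by (simp add: mult_ac)
qed

lemma a_factor_pos: "0 < 2 * \<gamma>1 * \<kappa>mdc * (1 - \<eta>2)"
  using \<gamma> \<kappa> \<eta>2 by simp

lemma a_pos: "0 < a"
proof -
  have "0 \<le> rpow (G 0) (1 - \<alpha>)"
    by (simp add: rpow_def)
  then show ?thesis
    unfolding a_def a_min_def using \<Delta>0_pos by (intro mult_pos_pos a_factor_pos) auto
qed

lemma a_le: "a \<le> 2 * \<gamma>1 * \<kappa>mdc * (1 - \<eta>2)"
proof -
  have "a \<le> 2 * \<gamma>1 * \<kappa>mdc * (1 - \<eta>2) * 1"
    unfolding a_def a_min_def by (intro mult_left_mono) (use a_factor_pos in auto)
  then show ?thesis by simp
qed

lemma a_le_radius:
  assumes "0 < G 0"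
  shows "a * G 0 powr (1 - \<alpha>) \<le> 2 * \<gamma>1 * \<kappa>mdc * (1 - \<eta>2) * \<Delta> 0"
proof -
  define c where "c = G 0 powr (1 - \<alpha>)"
  have c: "0 < c"
    using assms by (simp add: c_def)
  have "a * c = 2 * \<gamma>1 * \<kappa>mdc * (1 - \<eta>2) * (min 1 (\<Delta> 0 / c) * c)"
    using assms c by (simp add: a_def a_min_def rpow_pos_base c_def)
  also have "\<dots> \<le> 2 * \<gamma>1 * \<kappa>mdc * (1 - \<eta>2) * (\<Delta> 0 / c * c)"
    by (intro mult_left_mono mult_right_mono) (use a_factor_pos c in auto)
  finally show ?thesis
    using c by (simp add: c_def)
qed

lemma a_less_1: "a < 1"
  using a_le a_factor_lt \<gamma> by linarith

text \<open>
  This places the starting index: the quotient \<open>a \<epsilon>\<^bsup>1-\<alpha>\<^esup> / \<Delta> 0\<close> lies below \<open>\<gamma>2\<close>, so its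
  logarithm in base \<open>\<gamma>2\<close> exceeds \<open>1\<close>. The inequality also provides the base case of \<open>radius_ge\<close>.
\<close>
lemma a_powr_less:
  assumes "0 < \<epsilon>" "\<epsilon> < G 0"
  shows "a * \<epsilon> powr (1 - \<alpha>) < \<gamma>2 * \<Delta> 0"
proof -
  have "a * \<epsilon> powr (1 - \<alpha>) \<le> a * G 0 powr (1 - \<alpha>)"
    using assms \<alpha> a_pos by (intro mult_left_mono powr_mono2) auto
  also have "\<dots> \<le> 2 * \<gamma>1 * \<kappa>mdc * (1 - \<eta>2) * \<Delta> 0"
    using assms by (intro a_le_radius) linarith
  also have "\<dots> < \<gamma>2 * \<Delta> 0"
    by (intro mult_strict_right_mono less_le_trans[OF a_factor_lt] \<gamma> \<Delta>0_pos)
  finally show ?thesis .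
qed

lemma \<Phi>_nonneg: "0 \<le> u \<Longrightarrow> 0 \<le> \<Phi> u"
  unfolding \<Phi>_def using \<psi>_pos[OF L, of u \<beta>] by (intro divide_nonneg_pos) auto

lemma \<Phi>_antimono: "\<lbrakk>0 \<le> u; u \<le> v\<rbrakk> \<Longrightarrow> \<Phi> v \<le> \<Phi> u"
  unfolding \<Phi>_def using L \<beta> by (intro powr_over_\<psi>_antimono) auto

text \<open>
  The bound is nonincreasing in \<open>k\<close>, so it survives every step in which the radius does not shrink.
  The radius can shrink only if it exceeded \<open>2 \<kappa>mdc (1 - \<eta>2) G\<^sub>k\<^bsup>1-\<alpha>\<^esup> \<Phi>(\<parallel>B\<^sub>k\<parallel>)\<close>, and then the lost factor \<open>\<gamma>1\<close> is
  the one contained in \<open>a\<close>.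
\<close>
lemma radius_ge:
  assumes "0 < \<epsilon>" "\<And>i. i \<le> k \<Longrightarrow> \<epsilon> < G i"
  shows "a * \<epsilon> powr (1 - \<alpha>) * \<Phi> (H k) \<le> \<Delta> k"
  using assms(2)
proof (induction k)
  case 0
  have "\<Phi> (H 0) \<le> \<Phi> 0"
    by (intro \<Phi>_antimono H_nonneg) simp
  also have "\<dots> \<le> 1"
    using L by (simp add: \<Phi>_def \<psi>_def)
  finally have "a * \<epsilon> powr (1 - \<alpha>) * \<Phi> (H 0) \<le> a * \<epsilon> powr (1 - \<alpha>) * 1"
    using a_pos by (intro mult_left_mono) auto
  also have "\<dots> < \<gamma>2 * \<Delta> 0"
    using a_powr_less[OF assms(1)] 0 by simp
  also have "\<dots> \<le> 1 * \<Delta> 0"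
    using \<gamma> \<Delta>0_pos by (intro mult_right_mono) auto
  finally show ?case
    by simp
next
  case (Suc k)
  have G: "\<epsilon> < G k" "0 < G k"
    using Suc.prems[of k] assms(1) by auto
  have IH: "a * \<epsilon> powr (1 - \<alpha>) * \<Phi> (H k) \<le> \<Delta> k"
    using Suc by simp
  show ?case
  proof (cases "\<Delta> k \<le> 2 * \<kappa>mdc * (1 - \<eta>2) * (G k powr (1 - \<alpha>) * \<Phi> (b k))")
    case True
    have b1: "0 < (1 + b k) powr \<beta>"
      using b_nonneg[of k] by simp
    have "r k \<le> G k powr \<alpha> * (2 * \<kappa>mdc * (1 - \<eta>2) * (G k powr (1 - \<alpha>) * \<Phi> (b k)))
        / (1 + b k) powr \<beta>"
      unfolding r_eq[OF G(2)] using True b1 by (intro divide_right_mono mult_left_mono) auto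
    also have "\<dots> = 2 * \<kappa>mdc * (1 - \<eta>2) * (G k / \<psi> L \<beta> (b k))"
      using b1 G(2) by (simp add: \<Phi>_def powr_diff)
    also have "\<dots> \<le> 2 * \<kappa>mdc * (1 - \<eta>2) * (G k / (L + b k))"
      using \<kappa> \<eta>2 L b_nonneg[of k] by (intro mult_left_mono divide_left_mono \<psi>_ge mult_pos_pos \<psi>_pos) auto
    finally have "\<eta>2 \<le> \<rho> k"
      by (rule very_successful_if_small_radius[OF G(2)])
    then have "\<gamma>3 * \<Delta> k \<le> \<Delta> (Suc k)"
      using radius_update(1) by simp
    moreover have "1 * \<Delta> k \<le> \<gamma>3 * \<Delta> k"
      using \<gamma> radius_pos[of k] by (intro mult_right_mono) auto
    moreover have "a * \<epsilon> powr (1 - \<alpha>) * \<Phi> (H (Suc k)) \<le> a * \<epsilon> powr (1 - \<alpha>) * \<Phi> (H k)"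
      using a_pos monoD[OF mono_H, of k "Suc k"]
      by (intro mult_left_mono \<Phi>_antimono H_nonneg) auto
    ultimately show ?thesis
      using IH by linarith
  next
    case False
    have "a * \<epsilon> powr (1 - \<alpha>) * \<Phi> (H (Suc k))
        \<le> 2 * \<gamma>1 * \<kappa>mdc * (1 - \<eta>2) * G k powr (1 - \<alpha>) * \<Phi> (b k)"
      using G assms(1) \<alpha> a_le a_factor_pos b_le_H[of k] monoD[OF mono_H, of k "Suc k"]
      by (intro mult_mono powr_mono2 \<Phi>_antimono \<Phi>_nonneg H_nonneg b_nonneg) auto
    also have "\<dots> = \<gamma>1 * (2 * \<kappa>mdc * (1 - \<eta>2) * (G k powr (1 - \<alpha>) * \<Phi> (b k)))"
      by simp
    also have "\<dots> \<le> \<gamma>1 * \<Delta> k"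
      using False \<gamma> by (intro mult_left_mono) auto
    also note radius_shrink
    finally show ?thesis .
  qed
qed

section \<open>Weighted count of the successes\<close>

text \<open>
  The decrease is at least \<open>\<eta>1 \<kappa>mdc min {G\<^sub>k r\<^sub>k, G\<^sub>k\<^sup>2 / (1 + \<parallel>B\<^sub>k\<parallel>)}\<close>. In the first term the exponents combine:
  \<open>G\<^sub>k r\<^sub>k\<close> contains \<open>G\<^sub>k\<^bsup>1+\<alpha>\<^esup>\<close>, whose exponent is nonnegative even if \<open>\<alpha> < 0\<close>, and the lower bound on the
  radius supplies the missing \<open>\<epsilon>\<^bsup>1-\<alpha>\<^esup>\<close>. The second term satisfies the same bound because \<open>a < 1\<close> and \<open>L \<ge> 1\<close>.
\<close>
lemma successful_decrease:
  assumes "0 < \<epsilon>" "\<And>i. i \<le> k \<Longrightarrow> \<epsilon> < G i" and success: "k \<in> successes"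
  shows "\<eta>1 * \<kappa>mdc * a * \<epsilon>\<^sup>2 * (1 / \<psi> L \<beta> (H k)) \<le> f (x k) - f (x (Suc k))"
proof -
  have G: "\<epsilon> < G k" "0 < G k"
    using assms(2)[of k] assms(1) by auto
  have \<psi>: "0 < \<psi> L \<beta> (H k)"
    using L H_nonneg by (rule \<psi>_pos)
  have b1: "0 < 1 + b k" "0 < 1 + H k"
    using b_nonneg[of k] H_nonneg[of k] by auto
  have "a * \<epsilon>\<^sup>2 / \<psi> L \<beta> (H k)
      = \<epsilon> powr (1 + \<alpha>) * (a * \<epsilon> powr (1 - \<alpha>) * \<Phi> (H k)) / (1 + H k) powr \<beta>"
    using assms(1) b1 by (simp add: \<Phi>_def power2_eq_square powr_add powr_diff)
  also have "\<dots> \<le> G k powr (1 + \<alpha>) * \<Delta> k / (1 + b k) powr \<beta>"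
    using G assms(1) \<alpha> \<beta> a_pos b1 b_le_H[of k] radius_pos[of k] radius_ge[OF assms(1,2), of k]
      \<Phi>_nonneg[OF H_nonneg, of k]
    by (intro frac_le mult_mono powr_mono2) auto
  also have "\<dots> = G k * r k"
    using G(2) by (simp add: r_eq powr_add)
  finally have "a * \<epsilon>\<^sup>2 / \<psi> L \<beta> (H k) \<le> G k * r k" .
  moreover have "a * \<epsilon>\<^sup>2 / \<psi> L \<beta> (H k) \<le> G k * (G k / (1 + b k))"
  proof -
    have "a * \<epsilon>\<^sup>2 / \<psi> L \<beta> (H k) \<le> 1 * (G k)\<^sup>2 / (1 + b k)"
      using a_less_1 a_pos G assms(1) b1 b_le_H[of k] L \<psi>_ge[OF L H_nonneg, of k \<beta>]
      by (intro frac_le mult_mono power_mono) auto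
    then show ?thesis
      by (simp add: power2_eq_square)
  qed
  ultimately have "a * \<epsilon>\<^sup>2 / \<psi> L \<beta> (H k) \<le> G k * min (r k) (G k / (1 + b k))"
    by (simp add: min_def)
  then have "\<kappa>mdc * (a * \<epsilon>\<^sup>2 / \<psi> L \<beta> (H k)) \<le> \<kappa>mdc * (G k * min (r k) (G k / (1 + b k)))"
    using \<kappa> by (intro mult_left_mono) auto
  with predicted_ge[OF G(2)] have "\<kappa>mdc * (a * \<epsilon>\<^sup>2 / \<psi> L \<beta> (H k)) \<le> predicted k"
    by linarith
  then have "\<eta>1 * (\<kappa>mdc * (a * \<epsilon>\<^sup>2 / \<psi> L \<beta> (H k))) \<le> \<eta>1 * predicted k"
    using \<eta>1 by (intro mult_left_mono) auto
  also have "\<dots> \<le> f (x k) - f (x (Suc k))"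
    using success predicted_pos[OF G(2)]
    by (simp add: iterate_update) (simp add: successes_def \<rho>_eq field_simps)
  finally show ?thesis
    by (simp add: mult_ac)
qed

lemma sum_successes_le:
  assumes "0 < \<epsilon>" "\<And>i. i < k \<Longrightarrow> \<epsilon> < G i"
  shows "(\<Sum>j\<in>successes \<inter> {..<k}. 1 / \<psi> L \<beta> (H j)) \<le> (f (x 0) - flow) / (\<eta>1 * \<kappa>mdc * a * \<epsilon>\<^sup>2)"
proof -
  let ?c = "\<eta>1 * \<kappa>mdc * a * \<epsilon>\<^sup>2"
  have "?c * (\<Sum>j\<in>successes \<inter> {..<k}. 1 / \<psi> L \<beta> (H j)) \<le> f (x 0) - f (x k)"
    using assms(2)
  proof (induction k)
    case (Suc k)
    have "?c * (\<Sum>j\<in>successes \<inter> {..<k}. 1 / \<psi> L \<beta> (H j)) \<le> f (x 0) - f (x k)"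
      using Suc by simp
    moreover have "?c * (1 / \<psi> L \<beta> (H k)) \<le> f (x k) - f (x (Suc k))" if "k \<in> successes"
      using that Suc.prems by (intro successful_decrease assms(1)) auto
    moreover have "x (Suc k) = x k" if "k \<notin> successes"
      using that by (simp add: iterate_update)
    ultimately show ?case
      by (cases "k \<in> successes") (auto simp: lessThan_Suc Int_insert_right distrib_left)
  qed simp
  also have "\<dots> \<le> f (x 0) - flow"
    using bounded_below by simp
  finally show ?thesis
    using \<eta>1 \<kappa> a_pos assms(1) by (simp add: field_simps)
qed

section \<open>Iterations with few earlier successes\<close>
lemma radius_le:
  "\<Delta> k \<le> \<Delta> 0 * \<gamma>4 ^ card (successes \<inter> {..<k}) * \<gamma>2 ^ (k - card (successes \<inter> {..<k}))"
proof (induction k)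
  case (Suc k)
  let ?n = "card (successes \<inter> {..<k})"
  let ?U = "\<Delta> 0 * \<gamma>4 ^ ?n * \<gamma>2 ^ (k - ?n)"
  have n: "?n \<le> k"
    using card_mono[of "{..<k}" "successes \<inter> {..<k}"] by simp
  show ?case
  proof (cases "k \<in> successes")
    case True
    have "1 * \<Delta> k \<le> \<gamma>4 * \<Delta> k"
      using \<gamma> radius_pos[of k] by (intro mult_right_mono) auto
    then have "\<Delta> (Suc k) \<le> \<gamma>4 * \<Delta> k"
      using True radius_update(1,2)[of k] by (cases "\<eta>2 \<le> \<rho> k") (auto simp: successes_def)
    also have "\<dots> \<le> \<gamma>4 * ?U"
      using Suc \<gamma> by (intro mult_left_mono) auto
    finally show ?thesis
      using True by (simp add: lessThan_Suc Int_insert_right mult_ac)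
  next
    case False
    then have "\<Delta> (Suc k) \<le> \<gamma>2 * \<Delta> k"
      using radius_update(3)[of k] by (simp add: successes_def)
    also have "\<dots> \<le> \<gamma>2 * ?U"
      using Suc \<gamma> by (intro mult_left_mono) auto
    finally show ?thesis
      using False n by (simp add: lessThan_Suc Int_insert_right Suc_diff_le mult_ac)
  qed
qed simp

text \<open>
  The index is \<open>\<lceil>log\<^bsub>\<gamma>2\<^esub> (a \<epsilon>\<^bsup>1-\<alpha>\<^esup> / \<Delta>\<^sub>0)\<rceil>\<close>. Rounding up, as the third property requires, costs the
  summand \<open>1\<close> in \<open>\<kappa>4\<close>.
\<close>
lemma start_index:
  assumes "0 < \<epsilon>" "\<epsilon> < G 0"
  obtains m where "0 < m" "real m \<le> (1 - \<alpha>) * log \<gamma>2 \<epsilon> + (log \<gamma>2 (a / \<Delta> 0) + 1)"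
    "\<Delta> 0 * \<gamma>2 ^ m \<le> a * \<epsilon> powr (1 - \<alpha>)"
proof
  define q where "q = a * \<epsilon> powr (1 - \<alpha>) / \<Delta> 0"
  define m where "m = nat \<lceil>log \<gamma>2 q\<rceil>"
  have \<gamma>2: "0 < \<gamma>2" "\<gamma>2 < 1"
    using \<gamma> by auto
  have q: "0 < q" "q < \<gamma>2"
    using a_pos \<Delta>0_pos assms a_powr_less[OF assms] by (auto simp: q_def field_simps)
  have "log \<gamma>2 q = (1 - \<alpha>) * log \<gamma>2 \<epsilon> + log \<gamma>2 (a / \<Delta> 0)"
    using a_pos \<Delta>0_pos assms(1) by (simp add: q_def log_mult log_divide log_powr)
  moreover have "0 < log \<gamma>2 q"
    using q \<gamma>2 by (simp add: log_def divide_neg_neg)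
  ultimately show "0 < m" "real m \<le> (1 - \<alpha>) * log \<gamma>2 \<epsilon> + (log \<gamma>2 (a / \<Delta> 0) + 1)"
    unfolding m_def by linarith+
  have "log \<gamma>2 q \<le> real m"
    unfolding m_def by linarith
  then have "\<gamma>2 powr real m \<le> \<gamma>2 powr log \<gamma>2 q"
    using \<gamma>2 by (intro powr_mono') auto
  then have "\<gamma>2 ^ m \<le> q"
    using \<gamma>2 q by (simp add: powr_realpow)
  then show "\<Delta> 0 * \<gamma>2 ^ m \<le> a * \<epsilon> powr (1 - \<alpha>)"
    using \<Delta>0_pos by (simp add: q_def field_simps)
qed

lemma start_pos:
  assumes "0 < \<epsilon>" "\<epsilon> < G 0"
  shows "0 < (1 - \<alpha>) * log \<gamma>2 \<epsilon> + (log \<gamma>2 (a / \<Delta> 0) + 1)"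
proof -
  obtain m where "0 < m" "real m \<le> (1 - \<alpha>) * log \<gamma>2 \<epsilon> + (log \<gamma>2 (a / \<Delta> 0) + 1)"
    using start_index[OF assms] by blast
  then show ?thesis
    by linarith
qed

context
  fixes \<tau> :: nat
  assumes \<tau>: "0 < \<tau>" "\<gamma>4 * \<gamma>2 ^ (\<tau> - 1) < 1"
begin

definition \<theta> :: real where "\<theta> = (\<gamma>4 * \<gamma>2 ^ (\<tau> - 1)) powr (1 / real \<tau>)"

lemma \<theta>_powers: "(\<gamma>4 * \<gamma>2 ^ (\<tau> - 1)) powr (real k / real \<tau>) = \<theta> ^ k"
  using \<gamma> by (simp add: \<theta>_def powr_powr flip: powr_realpow)

lemma \<theta>_power_\<tau>: "\<theta> ^ \<tau> = \<gamma>4 * \<gamma>2 ^ (\<tau> - 1)"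
  using \<theta>_powers[of \<tau>] \<tau> \<gamma> by simp

lemma \<theta>_pos: "0 < \<theta>"
  using \<gamma> by (simp add: \<theta>_def)

lemma \<theta>_less_1: "\<theta> < 1"
  using \<tau> \<theta>_power_\<tau> \<theta>_pos by (metis linorder_not_less one_le_power)

lemma \<gamma>2_le_\<theta>: "\<gamma>2 \<le> \<theta>"
proof -
  have "\<gamma>2 ^ \<tau> = \<gamma>2 * \<gamma>2 ^ (\<tau> - 1)"
    using \<tau> by (simp flip: power_Suc)
  also have "\<dots> \<le> \<theta> ^ \<tau>"
    unfolding \<theta>_power_\<tau> using \<gamma> by (intro mult_right_mono) auto
  finally show ?thesis
    using \<tau> \<theta>_pos power_less_imp_less_base[of \<theta> \<tau> \<gamma>2] power_strict_mono[of \<theta> \<gamma>2 \<tau>]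
    by (meson less_imp_le linorder_not_less)
qed

text \<open>
  Group each success with \<open>\<tau> - 1\<close> failures: such a group multiplies the radius by
  \<open>\<gamma>4 \<gamma>2\<^bsup>\<tau>-1\<^esup> = \<theta>\<^sup>\<tau>\<close>. The hypothesis leaves at least \<open>m\<close> further failures, which contribute \<open>\<gamma>2\<^sup>m\<close>, and
  those beyond \<open>m\<close> contribute factors \<open>\<gamma>2 \<le> \<theta>\<close>.
\<close>
lemma radius_le_geometric:
  assumes "m \<le> k" "\<tau> * card (successes \<inter> {..<k}) \<le> k - m"
  shows "\<Delta> k \<le> \<Delta> 0 * \<gamma>2 ^ m * \<theta> ^ (k - m)"
proof -
  define n where "n = card (successes \<inter> {..<k})"
  define d where "d = k - m - \<tau> * n"
  have "n \<le> \<tau> * n"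
    using \<tau> by simp
  then have "k - n = m + d + (\<tau> - 1) * n" and exponent: "k - m = d + \<tau> * n"
    using assms by (auto simp: d_def n_def diff_mult_distrib)
  then have "\<gamma>4 ^ n * \<gamma>2 ^ (k - n) = \<gamma>2 ^ m * (\<gamma>2 ^ d * (\<gamma>4 * \<gamma>2 ^ (\<tau> - 1)) ^ n)"
    by (simp add: power_add power_mult power_mult_distrib)
  also have "\<dots> \<le> \<gamma>2 ^ m * (\<theta> ^ d * (\<theta> ^ \<tau>) ^ n)"
    unfolding \<theta>_power_\<tau> using \<gamma> \<gamma>2_le_\<theta> by (intro mult_left_mono mult_right_mono power_mono) auto
  also have "\<dots> = \<gamma>2 ^ m * \<theta> ^ (k - m)"
    by (simp add: exponent power_add power_mult)
  finally have "\<Delta> 0 * (\<gamma>4 ^ n * \<gamma>2 ^ (k - n)) \<le> \<Delta> 0 * (\<gamma>2 ^ m * \<theta> ^ (k - m))"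
    using \<Delta>0_pos by (intro mult_left_mono) auto
  then show ?thesis
    using radius_le[of k] by (simp add: n_def mult_ac)
qed

lemma summable_\<theta>: "summable (\<lambda>k. \<theta> ^ k)"
  using \<theta>_pos \<theta>_less_1 by (intro summable_geometric) simp

text \<open>
  At these indices \<open>radius_ge\<close> and \<open>radius_le_geometric\<close> squeeze the radius, and the choice of \<open>m\<close>
  cancels all dependence on \<open>\<epsilon>\<close> and \<open>\<Delta> 0\<close>.
\<close>
lemma sum_uncharged_le:
  assumes "0 < \<epsilon>" "\<And>i. i < k \<Longrightarrow> \<epsilon> < G i" and m: "\<Delta> 0 * \<gamma>2 ^ m \<le> a * \<epsilon> powr (1 - \<alpha>)"
  shows "(\<Sum>j | m \<le> j \<and> j < k \<and> \<tau> * card (successes \<inter> {..<j}) \<le> j - m. 1 / \<psi> L \<beta> (H j))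
    \<le> (\<Sum>j. \<theta> ^ j)"
proof -
  have "1 / \<psi> L \<beta> (H j) \<le> \<theta> ^ (j - m)"
    if j: "m \<le> j" "j < k" "\<tau> * card (successes \<inter> {..<j}) \<le> j - m" for j
  proof -
    have c: "0 < a * \<epsilon> powr (1 - \<alpha>)"
      using a_pos assms(1) by simp
    have "1 / \<psi> L \<beta> (H j) \<le> \<Phi> (H j)"
      using \<psi>_pos[OF L H_nonneg, of \<beta> j] H_nonneg[of j] \<beta>
      by (simp add: \<Phi>_def divide_right_mono ge_one_powr_ge_zero)
    then have "a * \<epsilon> powr (1 - \<alpha>) * (1 / \<psi> L \<beta> (H j)) \<le> a * \<epsilon> powr (1 - \<alpha>) * \<Phi> (H j)"
      using c by (intro mult_left_mono) auto
    also have "\<dots> \<le> \<Delta> j"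
      using j assms(1,2) by (intro radius_ge) auto
    also have "\<dots> \<le> \<Delta> 0 * \<gamma>2 ^ m * \<theta> ^ (j - m)"
      using j by (intro radius_le_geometric) auto
    also have "\<dots> \<le> a * \<epsilon> powr (1 - \<alpha>) * \<theta> ^ (j - m)"
      using m \<theta>_pos by (intro mult_right_mono) auto
    finally show ?thesis
      using c mult_le_cancel_left_pos by blast
  qed
  then have "(\<Sum>j | m \<le> j \<and> j < k \<and> \<tau> * card (successes \<inter> {..<j}) \<le> j - m. 1 / \<psi> L \<beta> (H j))
      \<le> (\<Sum>j | m \<le> j \<and> j < k \<and> \<tau> * card (successes \<inter> {..<j}) \<le> j - m. \<theta> ^ (j - m))"
    by (intro sum_mono) auto
  also have "\<dots> \<le> (\<Sum>j\<in>{m..<k}. \<theta> ^ (j - m))"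
    using \<theta>_pos by (intro sum_mono2) auto
  also have "\<dots> = (\<Sum>j<k - m. \<theta> ^ j)"
    by (rule sum.reindex_bij_witness[of _ "\<lambda>j. j + m" "\<lambda>j. j - m"]) auto
  also have "\<dots> \<le> (\<Sum>j. \<theta> ^ j)"
    using \<theta>_pos by (intro sum_le_suminf summable_\<theta>) auto
  finally show ?thesis .
qed

section \<open>Iteration counts along a run\<close>
lemma sum_inverse_\<psi>_le:
  assumes "0 < \<epsilon>" "\<And>i. i < k \<Longrightarrow> \<epsilon> < G i" and m: "\<Delta> 0 * \<gamma>2 ^ m \<le> a * \<epsilon> powr (1 - \<alpha>)"
  shows "(\<Sum>j\<in>{m..<k}. 1 / \<psi> L \<beta> (H j))
    \<le> real \<tau> * ((f (x 0) - flow) / (\<eta>1 * \<kappa>mdc * a * \<epsilon>\<^sup>2)) + (\<Sum>j. \<theta> ^ j)"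
proof -
  let ?w = "\<lambda>j. 1 / \<psi> L \<beta> (H j)"
  let ?charged = "{j. m \<le> j \<and> j < k \<and> j - m < \<tau> * card (successes \<inter> {..<j})}"
  let ?uncharged = "{j. m \<le> j \<and> j < k \<and> \<tau> * card (successes \<inter> {..<j}) \<le> j - m}"
  have "antimono ?w"
    using L by (intro antimonoI frac_le \<psi>_pos \<psi>_mono H_nonneg monoD[OF mono_H]) auto
  then have "sum ?w ?charged \<le> real \<tau> * sum ?w (successes \<inter> {..<k})"
    using \<psi>_pos[OF L H_nonneg] by (intro sum_charged_le) (auto intro: less_imp_le)
  also have "\<dots> \<le> real \<tau> * ((f (x 0) - flow) / (\<eta>1 * \<kappa>mdc * a * \<epsilon>\<^sup>2))"
    using assms(1,2) by (intro mult_left_mono sum_successes_le) auto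
  finally have charged: "sum ?w ?charged \<le> \<dots>" .
  have "{m..<k} = ?charged \<union> ?uncharged"
    by auto
  then have "sum ?w {m..<k} = sum ?w (?charged \<union> ?uncharged)"
    by (rule arg_cong)
  also have "\<dots> = sum ?w ?charged + sum ?w ?uncharged"
    by (rule sum.union_disjoint) auto
  finally show ?thesis
    using add_mono[OF charged sum_uncharged_le[OF assms]] by simp
qed

context
  fixes \<mu> p :: real
  assumes \<mu>: "0 < \<mu>" and p: "0 \<le> p" and growth: "\<And>j. H j \<le> \<mu> * (1 + real j powr p)"
begin

abbreviation budget :: "real \<Rightarrow> real" where
  "budget \<epsilon> \<equiv> \<psi> L \<beta> (2 * \<mu>) *
    (real \<tau> * ((f (x 0) - flow) / (\<eta>1 * \<kappa>mdc * a * \<epsilon>\<^sup>2)) + (\<Sum>j. \<theta> ^ j))"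

lemma budget_nonneg: "0 \<le> budget \<epsilon>"
  using \<psi>_pos[OF L, of "2 * \<mu>" \<beta>] \<mu> \<eta>1 \<kappa> a_pos bounded_below[of "x 0"] \<theta>_pos
  by (auto intro!: mult_nonneg_nonneg add_nonneg_nonneg suminf_nonneg summable_\<theta>
      divide_nonneg_nonneg)

text \<open>
  For \<open>j \<ge> 1\<close> the growth hypothesis gives \<open>H j \<le> 2 \<mu> j\<^sup>p\<close>, and \<open>\<psi>\<^sub>\<beta>(c t) \<le> \<psi>\<^sub>\<beta>(c) t\<close> for \<open>t \<ge> 1\<close>. The condition
  \<open>0 < m\<close> excludes \<open>j = 0\<close>, where \<open>j powr p\<close> vanishes but \<open>H j\<close> need not.
\<close>
lemma sum_power_le:
  assumes "0 < \<epsilon>" "\<And>i. i < k \<Longrightarrow> \<epsilon> < G i"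
    and m: "0 < m" "\<Delta> 0 * \<gamma>2 ^ m \<le> a * \<epsilon> powr (1 - \<alpha>)"
  shows "(\<Sum>j\<in>{m..<k}. real j powr (-p)) \<le> budget \<epsilon>"
proof -
  have \<psi>2\<mu>: "0 < \<psi> L \<beta> (2 * \<mu>)"
    using L \<mu> by (intro \<psi>_pos) auto
  have "real j powr (-p) \<le> \<psi> L \<beta> (2 * \<mu>) * (1 / \<psi> L \<beta> (H j))" if "m \<le> j" for j
  proof -
    have "1 \<le> real j"
      using that m by simp
    then have j: "1 \<le> real j powr p"
      using p by (intro ge_one_powr_ge_zero) auto
    have "\<mu> * (1 + real j powr p) \<le> 2 * \<mu> * real j powr p"
      using j \<mu> by simp
    then have "\<psi> L \<beta> (H j) \<le> \<psi> L \<beta> (2 * \<mu> * real j powr p)"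
      using growth[of j] L by (intro \<psi>_mono) auto
    also have "\<dots> \<le> \<psi> L \<beta> (2 * \<mu>) * real j powr p"
      using L j by (rule \<psi>_scale_le)
    finally show ?thesis
      using \<psi>_pos[OF L H_nonneg, of \<beta> j] \<open>1 \<le> real j\<close>
      by (simp add: powr_minus_divide pos_divide_le_eq pos_le_divide_eq mult.commute)
  qed
  then have "(\<Sum>j\<in>{m..<k}. real j powr (-p)) \<le> (\<Sum>j\<in>{m..<k}. \<psi> L \<beta> (2 * \<mu>) * (1 / \<psi> L \<beta> (H j)))"
    by (intro sum_mono) auto
  also have "\<dots> = \<psi> L \<beta> (2 * \<mu>) * (\<Sum>j\<in>{m..<k}. 1 / \<psi> L \<beta> (H j))"
    by (simp add: sum_distrib_left)
  also have "\<dots> \<le> budget \<epsilon>"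
    using \<psi>2\<mu> assms(1,2) m by (intro mult_left_mono sum_inverse_\<psi>_le) auto
  finally show ?thesis .
qed

lemma iterations_le_subcritical:
  assumes "0 < \<epsilon>" "\<And>i. i < k \<Longrightarrow> \<epsilon> < G i" and "p < 1"
  shows "real k \<le> ((1 - p) * budget \<epsilon>
      + ((1 - \<alpha>) * log \<gamma>2 \<epsilon> + (log \<gamma>2 (a / \<Delta> 0) + 1)) powr (1 - p)) powr (1 / (1 - p))"
proof (cases "k = 0")
  case False
  then obtain m where m: "0 < m" "real m \<le> (1 - \<alpha>) * log \<gamma>2 \<epsilon> + (log \<gamma>2 (a / \<Delta> 0) + 1)"
    "\<Delta> 0 * \<gamma>2 ^ m \<le> a * \<epsilon> powr (1 - \<alpha>)"
    using start_index assms(1,2) by blast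
  have "(\<Sum>j\<in>{m..<k}. real j powr (-p)) \<le> budget \<epsilon>"
    using assms(1,2) m by (intro sum_power_le) auto
  then show ?thesis
    using p \<open>p < 1\<close> budget_nonneg m by (intro count_le_of_power_sum) auto
qed simp

lemma iterations_le_critical:
  assumes "0 < \<epsilon>" "\<And>i. i < k \<Longrightarrow> \<epsilon> < G i" and "0 < k" and "p = 1"
  shows "real k \<le> ((1 - \<alpha>) * log \<gamma>2 \<epsilon> + (log \<gamma>2 (a / \<Delta> 0) + 1)) * exp (budget \<epsilon>)"
proof -
  obtain m where m: "0 < m" "real m \<le> (1 - \<alpha>) * log \<gamma>2 \<epsilon> + (log \<gamma>2 (a / \<Delta> 0) + 1)"
    "\<Delta> 0 * \<gamma>2 ^ m \<le> a * \<epsilon> powr (1 - \<alpha>)"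
    using start_index assms(1-3) by blast
  have "(\<Sum>j\<in>{m..<k}. real j powr (-p)) \<le> budget \<epsilon>"
    using assms(1,2) m by (intro sum_power_le) auto
  moreover have "(\<Sum>j\<in>{m..<k}. real j powr (-p)) = (\<Sum>j\<in>{m..<k}. 1 / real j)"
    using \<open>p = 1\<close> by (intro sum.cong) (auto simp: powr_minus_divide)
  ultimately show ?thesis
    using budget_nonneg m by (intro count_le_of_harmonic_sum) auto
qed

end

end

end

section \<open>The iteration bound\<close>

theorem theorem9:
  fixes f :: "real^'n \<Rightarrow> real" and g :: "real^'n \<Rightarrow> real^'n"
    and x s :: "nat \<Rightarrow> real^'n" and B :: "nat \<Rightarrow> real^'n^'n" and \<Delta> :: "nat \<Rightarrow> real"
    and \<eta>1 \<eta>2 \<gamma>1 \<gamma>2 \<gamma>3 \<gamma>4 \<kappa>mdc \<alpha> \<beta> L \<mu> p flow a \<xi> \<kappa>1 \<kappa>3 \<kappa>4 :: real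
    and \<tau> :: nat and k\<^sub>\<epsilon> :: "real \<Rightarrow> nat"
  assumes "0 < \<eta>1" "\<eta>1 \<le> \<eta>2" "\<eta>2 < 1"
    and "0 < \<gamma>1" "\<gamma>1 \<le> \<gamma>2" "\<gamma>2 < 1" "1 \<le> \<gamma>3" "\<gamma>3 \<le> \<gamma>4"
    and "0 < \<kappa>mdc" "\<kappa>mdc \<le> 1/2"
    and "-1 \<le> \<alpha>" "\<alpha> \<le> 1" "0 \<le> \<beta>" "\<beta> \<le> 1"
    and grad: "\<And>y. GDERIV f y :> g y" and C1: "continuous_on UNIV g"
    and bounded_below: "\<And>y. flow \<le> f y"
    and run: "tr_run \<eta>1 \<eta>2 \<gamma>1 \<gamma>2 \<gamma>3 \<gamma>4 \<kappa>mdc \<alpha> \<beta> f g x \<Delta> B s"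
    and "1 \<le> L"
    and model_error: "\<And>k. \<bar>f (x k + s k) - tr_model f g (x k) (B k) (s k)\<bar>
                        \<le> 1/2 * (L + opnorm (B k)) * (norm (s k))\<^sup>2"
    and "0 < \<mu>" "0 < p" "p \<le> 1"
    and hessian_growth: "\<And>k. (MAX j\<in>{0..k}. opnorm (B j)) \<le> \<mu> * (1 + real k powr p)"
    and inf_successful: "infinite {k. tr_ratio f g (x k) (B k) (s k) \<ge> \<eta>1}"
    and "0 < \<tau>" "\<gamma>4 * \<gamma>2 ^ (\<tau> - 1) < 1"
    and a: "a = a_min \<gamma>1 \<kappa>mdc \<eta>2 \<alpha> (\<Delta> 0) (norm (g (x 0)))"
    and \<xi>: "\<xi> = (\<Sum>k. (\<gamma>4 * \<gamma>2 ^ (\<tau> - 1)) powr (real k / real \<tau>))"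
    and \<kappa>1: "\<kappa>1 = (f (x 0) - flow) * \<psi> L \<beta> (2 * \<mu>) / (\<eta>1 * \<kappa>mdc * a)"
    and \<kappa>3: "\<kappa>3 = \<psi> L \<beta> (2 * \<mu>) * \<xi>"
    and \<kappa>4: "\<kappa>4 = log \<gamma>2 (a / \<Delta> 0) + 1"
    and k\<^sub>\<epsilon>: "\<And>\<epsilon>. k\<^sub>\<epsilon> \<epsilon> = (LEAST k. norm (g (x k)) \<le> \<epsilon>)"
  shows "summable (\<lambda>k. (\<gamma>4 * \<gamma>2 ^ (\<tau> - 1)) powr (real k / real \<tau>)) \<and> 0 \<le> \<kappa>1 \<and> 0 < \<kappa>3 \<and>
    (\<forall>\<epsilon>. 0 < \<epsilon> \<and> \<epsilon> < norm (g (x 0)) \<longrightarrow> 0 < (1 - \<alpha>) * log \<gamma>2 \<epsilon> + \<kappa>4) \<and>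
    (\<forall>\<epsilon>>0. \<exists>k. norm (g (x k)) \<le> \<epsilon>) \<and>
    (p < 1 \<longrightarrow>
      (\<forall>\<epsilon>>0. real (k\<^sub>\<epsilon> \<epsilon>) \<le>
        ((1 - p) * (real \<tau> * \<kappa>1 * \<epsilon> powr (-2) + \<kappa>3)
          + ((1 - \<alpha>) * log \<gamma>2 \<epsilon> + \<kappa>4) powr (1 - p)) powr (1 / (1 - p))) \<and>
      (\<lambda>\<epsilon>. ((1 - p) * (real \<tau> * \<kappa>1 * \<epsilon> powr (-2) + \<kappa>3)
          + ((1 - \<alpha>) * log \<gamma>2 \<epsilon> + \<kappa>4) powr (1 - p)) powr (1 / (1 - p)))
        \<in> O[at_right 0](\<lambda>\<epsilon>. ((1 - p) * \<epsilon> powr (-2)) powr (1 / (1 - p)))) \<and>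
    (p = 1 \<longrightarrow>
      (\<forall>\<epsilon>>0. \<epsilon> < norm (g (x 0)) \<or> 0 \<le> (1 - \<alpha>) * log \<gamma>2 \<epsilon> + \<kappa>4 \<longrightarrow>
        real (k\<^sub>\<epsilon> \<epsilon>) \<le>
          ((1 - \<alpha>) * log \<gamma>2 \<epsilon> + \<kappa>4) * exp (real \<tau> * \<kappa>1 * \<epsilon> powr (-2) + \<kappa>3)))"
proof -
  interpret tr: trust_region_run f g x s B \<Delta> \<eta>1 \<eta>2 \<gamma>1 \<gamma>2 \<gamma>3 \<gamma>4 \<kappa>mdc \<alpha> \<beta> L flow
    by unfold_locales (fact assms)+
  have tr_a: "tr.a = a"
    by (simp add: tr.a_def a)
  note \<tau> = \<open>0 < \<tau>\<close> \<open>\<gamma>4 * \<gamma>2 ^ (\<tau> - 1) < 1\<close>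
  have growth: "tr.H j \<le> \<mu> * (1 + real j powr p)" for j
    unfolding tr.H_def by (rule hessian_growth)
  have \<psi>2\<mu>: "0 < \<psi> L \<beta> (2 * \<mu>)"
    using assms by (intro \<psi>_pos) auto
  have summable: "summable (\<lambda>k. (\<gamma>4 * \<gamma>2 ^ (\<tau> - 1)) powr (real k / real \<tau>))"
    unfolding tr.\<theta>_powers[OF \<tau>] by (rule tr.summable_\<theta>[OF \<tau>])
  have \<kappa>1_nonneg: "0 \<le> \<kappa>1"
    using \<psi>2\<mu> tr.a_pos bounded_below[of "x 0"] assms by (simp add: tr_a \<kappa>1)
  have "0 < \<xi>"
    unfolding \<xi> using assms by (intro suminf_pos summable) auto
  then have \<kappa>3_pos: "0 < \<kappa>3"
    using \<psi>2\<mu> by (simp add: \<kappa>3)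
  have budget: "tr.budget \<tau> \<mu> \<epsilon> = real \<tau> * \<kappa>1 * \<epsilon> powr (-2) + \<kappa>3" if "0 < \<epsilon>" for \<epsilon>
    unfolding \<kappa>1 \<kappa>3 \<xi> tr.\<theta>_powers[OF \<tau>] using that
    by (simp add: tr_a powr_minus_divide distrib_left)
  have start: "0 < (1 - \<alpha>) * log \<gamma>2 \<epsilon> + \<kappa>4" if "0 < \<epsilon>" "\<epsilon> < norm (g (x 0))" for \<epsilon>
    using tr.start_pos[OF that] by (simp add: tr_a \<kappa>4)
  have subcritical: "real k \<le> ((1 - p) * (real \<tau> * \<kappa>1 * \<epsilon> powr (-2) + \<kappa>3)
      + ((1 - \<alpha>) * log \<gamma>2 \<epsilon> + \<kappa>4) powr (1 - p)) powr (1 / (1 - p))"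
    if "p < 1" "0 < \<epsilon>" "\<And>i. i < k \<Longrightarrow> \<epsilon> < norm (g (x i))" for k \<epsilon>
    using tr.iterations_le_subcritical[OF \<tau> \<open>0 < \<mu>\<close> _ growth that(2,3,1)] \<open>0 < p\<close>
    unfolding budget[OF that(2)] by (simp add: tr_a \<kappa>4)
  have critical: "real k \<le> ((1 - \<alpha>) * log \<gamma>2 \<epsilon> + \<kappa>4) * exp (real \<tau> * \<kappa>1 * \<epsilon> powr (-2) + \<kappa>3)"
    if "p = 1" "0 < \<epsilon>" "\<And>i. i < k \<Longrightarrow> \<epsilon> < norm (g (x i))" "0 < k" for k \<epsilon>
    using tr.iterations_le_critical[OF \<tau> \<open>0 < \<mu>\<close> _ growth that(2,3,4,1)] \<open>0 < p\<close>
    unfolding budget[OF that(2)] by (simp add: tr_a \<kappa>4)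
  \<comment> \<open>The bounds hold for every \<open>k\<close> before which the tolerance has not been reached, so at most
    finitely many such \<open>k\<close> exist.\<close>
  have reached: "\<exists>k. norm (g (x k)) \<le> \<epsilon>" if "0 < \<epsilon>" for \<epsilon>
  proof (rule ccontr)
    assume "\<nexists>k. norm (g (x k)) \<le> \<epsilon>"
    then have never: "\<epsilon> < norm (g (x i))" for i
      by (meson linorder_not_less)
    have "\<exists>C. \<forall>k>0. real k \<le> C"
    proof (cases "p = 1")
      case True
      then show ?thesis
        using critical \<open>0 < \<epsilon>\<close> never by blast
    next
      case False
      then show ?thesis
        using subcritical \<open>0 < \<epsilon>\<close> never \<open>p \<le> 1\<close> by (meson order_le_less)
    qed
    then show False
      by (metis gr0I less_le_not_le linorder_not_less of_nat_0_less_iff order_trans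
          reals_Archimedean2 of_nat_0)
  qed
  have before: "\<epsilon> < norm (g (x i))" if "i < k\<^sub>\<epsilon> \<epsilon>" for i \<epsilon>
    using not_less_Least[OF that[unfolded k\<^sub>\<epsilon>]] by simp
  \<comment> \<open>For \<open>k\<^sub>\<epsilon> \<epsilon> = 0\<close> the claim is that the first factor is nonnegative.\<close>
  have bound_1: "real (k\<^sub>\<epsilon> \<epsilon>) \<le> ((1 - \<alpha>) * log \<gamma>2 \<epsilon> + \<kappa>4) * exp (real \<tau> * \<kappa>1 * \<epsilon> powr (-2) + \<kappa>3)"
    if "p = 1" "0 < \<epsilon>" "\<epsilon> < norm (g (x 0)) \<or> 0 \<le> (1 - \<alpha>) * log \<gamma>2 \<epsilon> + \<kappa>4" for \<epsilon>
  proof (cases "k\<^sub>\<epsilon> \<epsilon> = 0")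
    case True
    have "0 \<le> (1 - \<alpha>) * log \<gamma>2 \<epsilon> + \<kappa>4"
      using that start[of \<epsilon>] by linarith
    with True show ?thesis
      by simp
  next
    case False
    then show ?thesis
      using that before by (intro critical) auto
  qed
  show ?thesis
  proof (intro conjI impI allI; (elim conjE)?)
    show "(\<lambda>\<epsilon>. ((1 - p) * (real \<tau> * \<kappa>1 * \<epsilon> powr (-2) + \<kappa>3)
          + ((1 - \<alpha>) * log \<gamma>2 \<epsilon> + \<kappa>4) powr (1 - p)) powr (1 / (1 - p)))
        \<in> O[at_right 0](\<lambda>\<epsilon>. ((1 - p) * \<epsilon> powr (-2)) powr (1 / (1 - p)))" if "p < 1"
      using that \<open>0 < p\<close> \<kappa>1_nonneg \<kappa>3_pos tr.\<gamma> \<open>\<alpha> \<le> 1\<close>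
      by (intro iteration_bound_bigo mult_nonneg_nonneg) simp_all
  qed (use summable \<kappa>1_nonneg \<kappa>3_pos start reached subcritical before bound_1 in auto)
qed

end
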